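(* Let $r \ge 2$ be an integer and let $P$ be an $r$-partite $r$-pattern. Consider any integer $m\ge 2$ such that $m-1$ is divisible by $r-1$, and any integer $b\ge r(m-1)/(r-1)$. Then, defining \[ n=\binom{b+r-(m-1)/(r-1)}{r}-\binom{b+r-r(m-1)/(r-1)}{r}, \] we have \[N_{P,m}^{\mathrm{part}}(n)\ge e^{-rn}(r!)^{-(r/(r-1))n} (m-1)^{(r/(r-1))n} n^{(r-1-1/(r-1))n}.\]
   Context: An (ordered) $r$-matching is an $r$-uniform hypergraph on a totally ordered vertex set in which every vertex is contained in exactly one edge; its size is its number of edges. An $r$-matching is $r$-partite if, when the vertex set is divided into $r$ contiguous intervals of equal length, every edge has exactly one vertex in each interval. An $r$-pattern is an $r$-matching of size $2$ on the vertex set $\{1,\dots,2r\}$. An $r$-matching is a $P$-clique if every pair of its edges (with the induced ordering on their $2r$ vertices) is order-isomorphic to $P$; $L_P(M)$ is the size of the largest $P$-clique formed by a subset of the edges of $M$. $N_{P,m}^{\mathrm{part}}(n)$ is the number of $r$-partite $r$-matchings $M$ on the vertex set $\{1,\dots,rn\}$ with $L_P(M)<m$. *)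

theory Defs
  imports Complex_Main
begin

text \<open>
  An ordered hypergraph is represented by its set of edges; the order on the vertices is the one of
  the ambient type. In a matching every vertex is covered, so the vertex set is the union
  of the edges.
\<close>

definition r_matching :: "nat \<Rightarrow> 'a::linorder set \<Rightarrow> 'a set set \<Rightarrow> bool" where
  "r_matching r V M \<longleftrightarrow> (\<forall>e\<in>M. e \<subseteq> V \<and> finite e \<and> card e = r) \<and> (\<forall>v\<in>V. \<exists>!e. e \<in> M \<and> v \<in> e)"

text \<open>Only for matchings on the vertex set \<open>{1..r * n}\<close>, whose \<open>i\<close>-th interval
  (\<open>i = 0, \<dots>, r - 1\<close>) is \<open>{i * n + 1..(i + 1) * n}\<close>.\<close>

definition r_partite :: "nat \<Rightarrow> nat \<Rightarrow> nat set set \<Rightarrow> bool" where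
  "r_partite r n M \<longleftrightarrow> (\<forall>e\<in>M. \<forall>i<r. card (e \<inter> {i * n + 1..(i + 1) * n}) = 1)"

definition r_pattern :: "nat \<Rightarrow> nat set set \<Rightarrow> bool" where
  "r_pattern r P \<longleftrightarrow> r_matching r {1..2 * r} P \<and> card P = 2"

definition order_isomorphic :: "'a::linorder set set \<Rightarrow> 'b::linorder set set \<Rightarrow> bool" where
  "order_isomorphic G H \<longleftrightarrow> (\<exists>\<phi>. strict_mono_on (\<Union>G) \<phi> \<and> (\<lambda>e. \<phi> ` e) ` G = H)"

definition pattern_clique :: "nat \<Rightarrow> nat set set \<Rightarrow> 'a::linorder set set \<Rightarrow> bool" where
  "pattern_clique r P C \<longleftrightarrow>
     r_matching r (\<Union>C) C \<and> (\<forall>e\<in>C. \<forall>f\<in>C. e \<noteq> f \<longrightarrow> order_isomorphic {e, f} P)"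

definition largest_clique :: "nat \<Rightarrow> nat set set \<Rightarrow> 'a::linorder set set \<Rightarrow> nat" where
  "largest_clique r P M = Max {card C |C. C \<subseteq> M \<and> pattern_clique r P C}"

definition N_part :: "nat \<Rightarrow> nat set set \<Rightarrow> nat \<Rightarrow> nat \<Rightarrow> nat" where
  "N_part r P m n =
     card {M. r_matching r {1..r * n} M \<and> r_partite r n M \<and> largest_clique r P M < m}"

end

theory Submission
  imports Defs "HOL-Library.FuncSet" "HOL-Combinatorics.Permutations"
begin

text \<open>
  Write \<open>s = (m - 1) / (r - 1)\<close> and let \<open>Q\<close> be the set of points of \<open>\<nat>\<^sup>r\<close> whose coordinate sum lies
  in the interval from \<open>b - r s + 1\<close> to \<open>b - s\<close>. A stars-and-bars count shows that \<open>Q\<close> has exactly \<open>n\<close>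
  points. A chain in the product order has strictly increasing coordinate sums, and only \<open>m - 1\<close> sums
  are possible; so \<open>Q\<close> has no chain of \<open>m\<close> points.

  The points of \<open>Q\<close> share coordinates. Choose, for every \<open>i\<close>, a bijection \<open>\<sigma> i\<close> from \<open>Q\<close> onto the positions
  \<open>0, \<dots>, n - 1\<close> that breaks these ties: it respects the order of the \<open>i\<close>-th coordinates, or reverses it,
  according to whether the two edges of \<open>P\<close> appear in the same order in the interval \<open>i\<close> as in a fixed
  orientation of \<open>P\<close>. Each point becomes an edge with one vertex per interval, and the result is an
  \<open>r\<close>-partite matching. Two edges that form \<open>P\<close> come from two comparable points, so a \<open>P\<close>-clique comes
  from a chain and has fewer than \<open>m\<close> edges (\<open>largest_clique_matching_of\<close>).

  It remains to count the tie-breakings. They are obtained from one of them by composing each \<open>\<sigma> i\<close>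
  with a permutation of \<open>Q\<close> that preserves the \<open>i\<close>-th coordinate, and different choices give different
  matchings, because an edge determines the coordinates of its point. Every coordinate is one of
  \<open>K = b - s + 1\<close> values, so a coordinate function has at most \<open>K ^ n\<close> rearrangements under the \<open>n!\<close>
  permutations of \<open>Q\<close>, and its stabiliser has at least \<open>n! / K ^ n\<close> elements
  (\<open>fact_le_card_stabiliser\<close>). Hence there are at least \<open>(n! / K ^ n) ^ r\<close> matchings
  (\<open>fact_power_le_N_part\<close>).

  Finally, \<open>n! \<ge> (n / e) ^ n\<close>, and \<open>K\<close> is eliminated by the volume estimate
  \<open>(m - 1) * K ^ (r - 1) \<le> r! * n\<close> (\<open>layer_volume_bound\<close>), which says \<open>K \<le> (r! n / (m - 1))\<^bsup>1 / (r - 1)\<^esup>\<close>;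
  this gives the claimed bound.
\<close>

section \<open>Matchings from families of bijections\<close>

text \<open>
  The intervals are indexed from \<open>0\<close> and positions inside an interval run from \<open>0\<close> to \<open>n - 1\<close>, while the
  vertices start at \<open>1\<close>; this is where the \<open>+ 1\<close> comes from. The edge has its vertex in the
  interval \<open>i\<close> at position \<open>c i\<close>.
\<close>

definition edge :: "nat \<Rightarrow> nat \<Rightarrow> (nat \<Rightarrow> nat) \<Rightarrow> nat set" where
  "edge r n c = (\<lambda>i. i * n + 1 + c i) ` {..<r}"

definition matching_of :: "nat \<Rightarrow> nat \<Rightarrow> 'a set \<Rightarrow> (nat \<Rightarrow> 'a \<Rightarrow> nat) \<Rightarrow> nat set set" where
  "matching_of r n Q \<sigma> = (\<lambda>x. edge r n (\<lambda>i. \<sigma> i x)) ` Q"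

lemma block_position_unique:
  fixes i j n k l :: nat
  assumes "i * n + 1 + k = j * n + 1 + l" "k < n" "l < n"
  shows "i = j \<and> k = l"
proof -
  have "(i * n + k) div n = i" "(i * n + k) mod n = k"
       "(j * n + l) div n = j" "(j * n + l) mod n = l" using assms(2,3) by auto
  moreover have "i * n + k = j * n + l" using assms(1) by simp
  ultimately show ?thesis by metis
qed

lemma mem_edge_iff:
  assumes "\<And>i. i < r \<Longrightarrow> c i < n" "i < r" "k < n"
  shows "i * n + 1 + k \<in> edge r n c \<longleftrightarrow> c i = k"
proof
  assume "i * n + 1 + k \<in> edge r n c"
  then obtain j where j: "j < r" "i * n + 1 + k = j * n + 1 + c j" by (auto simp: edge_def)
  from block_position_unique[OF j(2) assms(3) assms(1)[OF j(1)]] show "c i = k" by blast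
next
  assume "c i = k"
  then show "i * n + 1 + k \<in> edge r n c" using assms(2) by (auto simp: edge_def)
qed

lemma edge_eqD:
  assumes "\<And>i. i < r \<Longrightarrow> c i < n" "\<And>i. i < r \<Longrightarrow> d i < n" "edge r n c = edge r n d" "i < r"
  shows "c i = d i"
  using mem_edge_iff[of r c n i "d i", OF assms(1)] mem_edge_iff[of r d n i "d i", OF assms(2)]
    assms(2)[OF assms(4)] assms(3,4) by simp

lemma edge_inter_block:
  assumes "\<And>i. i < r \<Longrightarrow> c i < n" "i < r"
  shows "edge r n c \<inter> {i * n + 1..(i + 1) * n} = {i * n + 1 + c i}"
proof -
  have "v = i * n + 1 + c i" if v: "v \<in> edge r n c" "i * n + 1 \<le> v" "v \<le> (i + 1) * n" for v
  proof -
    define k where "k = v - (i * n + 1)"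
    have k: "v = i * n + 1 + k" "k < n" using v by (simp_all add: k_def)
    then show ?thesis using mem_edge_iff[OF assms k(2)] v(1) by simp
  qed
  moreover have "i * n + 1 + c i \<in> edge r n c" using assms(2) by (auto simp: edge_def)
  moreover have "i * n + 1 + c i \<le> (i + 1) * n" using assms(1)[OF assms(2)] by simp
  moreover have "i * n + 1 \<le> i * n + 1 + c i" by simp
  ultimately show ?thesis
    unfolding set_eq_iff Int_iff atLeastAtMost_iff singleton_iff by blast
qed

lemma card_edge:
  assumes "\<And>i. i < r \<Longrightarrow> c i < n"
  shows "card (edge r n c) = r"
proof -
  have "inj_on (\<lambda>i. i * n + 1 + c i) {..<r}"
    using block_position_unique[OF _ assms assms] by (intro inj_onI) blast
  then show ?thesis by (simp add: edge_def card_image)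
qed

lemma edge_subset:
  assumes "\<And>i. i < r \<Longrightarrow> c i < n"
  shows "edge r n c \<subseteq> {1..r * n}"
proof
  fix v assume "v \<in> edge r n c"
  then obtain i where i: "i < r" "v = i * n + 1 + c i" by (auto simp: edge_def)
  have "v \<le> (i + 1) * n" using i assms[of i] by simp
  also have "\<dots> \<le> r * n" using i by (intro mult_right_mono) auto
  finally show "v \<in> {1..r * n}" using i by auto
qed

lemma bij_betw_lessThan_bound:
  fixes n :: nat
  shows "bij_betw f Q {..<n} \<Longrightarrow> x \<in> Q \<Longrightarrow> f x < n"
  using bij_betwE by blast

text \<open>
  A vertex lies in exactly one interval \<open>i\<close>, at a position \<open>k\<close>; the edges through it are those of the
  points \<open>x\<close> with \<open>\<sigma> i x = k\<close>, and bijectivity of \<open>\<sigma> i\<close> leaves exactly one.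
\<close>

lemma r_matching_matching_of:
  assumes bij: "\<And>i. i < r \<Longrightarrow> bij_betw (\<sigma> i) Q {..<n}"
  shows "r_matching r {1..r * n} (matching_of r n Q \<sigma>)"
proof -
  note lt = bij_betw_lessThan_bound[OF bij]
  have "\<exists>!e. e \<in> matching_of r n Q \<sigma> \<and> v \<in> e" if v: "v \<in> {1..r * n}" for v
  proof -
    define i k where "i = (v - 1) div n" and "k = (v - 1) mod n"
    have n: "n > 0" using v by (cases n) auto
    have k: "k < n" using n by (simp add: k_def)
    have v_eq: "v = i * n + 1 + k"
      using v div_mult_mod_eq[of "v - 1" n] by (simp add: i_def k_def)
    have "v - 1 < r * n" using v by auto
    then have i: "i < r" by (simp add: i_def less_mult_imp_div_less)
    have mem: "v \<in> edge r n (\<lambda>i. \<sigma> i x) \<longleftrightarrow> \<sigma> i x = k" if "x \<in> Q" for x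
      unfolding v_eq using mem_edge_iff[of r "\<lambda>i. \<sigma> i x" n i k] lt that i k by auto
    obtain x where x: "x \<in> Q" "\<sigma> i x = k"
      using bij[OF i] k by (metis bij_betw_iff_bijections lessThan_iff)
    have "y = x" if "y \<in> Q" "\<sigma> i y = k" for y
      using bij[OF i] x that by (metis bij_betw_inv_into_left)
    then show ?thesis unfolding matching_of_def using x mem by blast
  qed
  moreover have "e \<subseteq> {1..r * n} \<and> finite e \<and> card e = r" if "e \<in> matching_of r n Q \<sigma>" for e
  proof -
    obtain x where x: "x \<in> Q" "e = edge r n (\<lambda>i. \<sigma> i x)"
      using \<open>e \<in> matching_of r n Q \<sigma>\<close> by (auto simp: matching_of_def)
    then show ?thesis using edge_subset[of r "\<lambda>i. \<sigma> i x" n] card_edge[of r "\<lambda>i. \<sigma> i x" n] lt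
      by (auto simp: edge_def)
  qed
  ultimately show ?thesis by (auto simp: r_matching_def)
qed

lemma r_partite_matching_of:
  assumes "\<And>i. i < r \<Longrightarrow> bij_betw (\<sigma> i) Q {..<n}"
  shows "r_partite r n (matching_of r n Q \<sigma>)"
  unfolding r_partite_def
proof (intro ballI allI impI)
  fix e i assume "e \<in> matching_of r n Q \<sigma>" and i: "i < r"
  then obtain x where x: "x \<in> Q" "e = edge r n (\<lambda>i. \<sigma> i x)" by (auto simp: matching_of_def)
  then have "e \<inter> {i * n + 1..(i + 1) * n} = {i * n + 1 + \<sigma> i x}"
    using edge_inter_block[of r "\<lambda>i. \<sigma> i x" n i] bij_betw_lessThan_bound[OF assms] i by auto
  then show "card (e \<inter> {i * n + 1..(i + 1) * n}) = 1" by simp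
qed

section \<open>Cliques and chains\<close>

text \<open>
  The chain \<open>lo 0 < hi 0 < lo 1 < hi 1 < \<dots>\<close> has \<open>2 r\<close> terms and is mapped into \<open>2 r\<close> consecutive integers,
  which leaves no freedom: counting from the left bounds each value below, counting from the right
  bounds it above.
\<close>

lemma strict_mono_on_pairs_eq:
  fixes \<phi> :: "'a::linorder \<Rightarrow> nat"
  assumes mono: "strict_mono_on S \<phi>" and img: "\<phi> ` S \<subseteq> {1..2 * r}"
    and S: "\<And>i. i < r \<Longrightarrow> lo i \<in> S \<and> hi i \<in> S \<and> lo i < hi i"
    and step: "\<And>i. Suc i < r \<Longrightarrow> hi i < lo (Suc i)"
    and i: "i < r"
  shows "\<phi> (lo i) = 2 * i + 1 \<and> \<phi> (hi i) = 2 * i + 2"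
proof -
  have lohi: "\<phi> (lo i) < \<phi> (hi i)" if "i < r" for i
    using S[OF that] mono by (auto simp: strict_mono_on_def)
  have hilo: "\<phi> (hi i) < \<phi> (lo (Suc i))" if "Suc i < r" for i
    using S[of i] S[of "Suc i"] step that mono by (auto simp: strict_mono_on_def)
  have lower: "2 * i + 1 \<le> \<phi> (lo i)" if "i < r" for i
    using that
  proof (induction i)
    case 0
    then show ?case using S img by (fastforce simp: image_subset_iff)
  next
    case (Suc i)
    then show ?case using lohi[of i] hilo[of i] by auto
  qed
  have upper: "\<phi> (hi i) + 2 * d \<le> 2 * r" if "i + d + 1 = r" for i d
    using that
  proof (induction d arbitrary: i)
    case 0
    then show ?case using S[of i] img by (auto simp: image_subset_iff)
  next
    case (Suc d)
    then show ?case using Suc.IH[of "Suc i"] lohi[of "Suc i"] hilo[of i] by auto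
  qed
  from i obtain d where "i + d + 1 = r" by (metis Suc_eq_plus1 add_Suc_right less_natE)
  then show ?thesis using lower[OF i] upper[of i d] lohi[OF i] by linarith
qed

text \<open>
  The two vertices of \<open>e \<union> f\<close> in the interval \<open>i\<close> are sent to \<open>2 i + 1\<close> and \<open>2 i + 2\<close>, in this order. So
  the edge that comes first in the interval \<open>i\<close> can be read off from the odd number \<open>2 i + 1\<close>.
\<close>

lemma edge_pair_order_type_aux:
  assumes c: "\<And>i. i < r \<Longrightarrow> c i < n" and d: "\<And>i. i < r \<Longrightarrow> d i < n"
    and ne: "\<And>i. i < r \<Longrightarrow> c i \<noteq> d i"
    and mono: "strict_mono_on (edge r n c \<union> edge r n d) \<phi>"
    and img: "\<phi> ` (edge r n c \<union> edge r n d) \<subseteq> {1..2 * r}"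
    and p: "\<phi> ` edge r n c = p"
    and one: "\<And>i. i < r \<Longrightarrow> card (p \<inter> {2 * i + 1, 2 * i + 2}) = 1"
    and i: "i < r"
  shows "c i < d i \<longleftrightarrow> 2 * i + 1 \<in> p"
proof -
  let ?lo = "\<lambda>i. i * n + 1 + min (c i) (d i)" and ?hi = "\<lambda>i. i * n + 1 + max (c i) (d i)"
  have val: "\<phi> (?lo i) = 2 * i + 1 \<and> \<phi> (?hi i) = 2 * i + 2"
  proof (rule strict_mono_on_pairs_eq[OF mono img _ _ i])
    fix i assume "i < r"
    then show "?lo i \<in> edge r n c \<union> edge r n d \<and> ?hi i \<in> edge r n c \<union> edge r n d \<and> ?lo i < ?hi i"
      using ne[of i] by (auto simp: edge_def min_def max_def)
  next
    fix i assume "Suc i < r"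
    then show "?hi i < ?lo (Suc i)" using c[of i] d[of i] by auto
  qed
  have mem: "\<phi> (i * n + 1 + c i) \<in> p" using p i by (auto simp: edge_def)
  show ?thesis
  proof (cases "c i < d i")
    case True
    then show ?thesis using val mem by (simp add: min_def)
  next
    case False
    then have "2 * i + 2 \<in> p" using val mem ne[OF i] by (simp add: max_def split: if_splits)
    moreover have "2 * i + 1 \<notin> p"
    proof
      assume "2 * i + 1 \<in> p"
      then have "p \<inter> {2 * i + 1, 2 * i + 2} = {2 * i + 1, 2 * i + 2}"
        using \<open>2 * i + 2 \<in> p\<close> by auto
      then show False using one[OF i] by simp
    qed
    ultimately show ?thesis using False by simp
  qed
qed

text \<open>
  An order isomorphism onto \<open>P\<close> may send either edge of the pair to \<open>p\<close>, hence the two alternatives. The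
  set of \<open>i\<close> with \<open>2 i + 1 \<in> p\<close> encodes \<open>P\<close>: these are the intervals in which \<open>p\<close> comes first.
\<close>

lemma edge_pair_order_type:
  assumes P: "r_pattern r P" "r_partite r 2 P" "p \<in> P"
    and c: "\<And>i. i < r \<Longrightarrow> c i < n" and d: "\<And>i. i < r \<Longrightarrow> d i < n"
    and ne: "\<And>i. i < r \<Longrightarrow> c i \<noteq> d i"
    and iso: "order_isomorphic {edge r n c, edge r n d} P"
  shows "(\<forall>i<r. c i < d i \<longleftrightarrow> 2 * i + 1 \<in> p) \<or> (\<forall>i<r. d i < c i \<longleftrightarrow> 2 * i + 1 \<in> p)"
proof -
  obtain \<phi> where mono: "strict_mono_on (edge r n c \<union> edge r n d) \<phi>"
    and img: "P = {\<phi> ` edge r n c, \<phi> ` edge r n d}"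
    using iso by (auto simp: order_isomorphic_def)
  have sub: "\<phi> ` (edge r n c \<union> edge r n d) \<subseteq> {1..2 * r}"
    using P(1) img unfolding r_pattern_def r_matching_def by (simp add: image_Un)
  have one: "card (p \<inter> {2 * i + 1, 2 * i + 2}) = 1" if "i < r" for i
  proof -
    have "{2 * i + 1, 2 * i + 2} = {i * 2 + 1..(i + 1) * 2}" by auto
    then show ?thesis using P(2,3) that by (auto simp: r_partite_def)
  qed
  from P(3) img consider "\<phi> ` edge r n c = p" | "\<phi> ` edge r n d = p" by auto
  then show ?thesis
  proof cases
    case 1
    then show ?thesis using edge_pair_order_type_aux[OF c d ne mono sub _ one] by auto
  next
    case 2
    have mono': "strict_mono_on (edge r n d \<union> edge r n c) \<phi>"
      and sub': "\<phi> ` (edge r n d \<union> edge r n c) \<subseteq> {1..2 * r}"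
      using mono sub by (simp_all add: Un_commute)
    show ?thesis using edge_pair_order_type_aux[OF d c ne[symmetric] mono' sub' 2 one] by auto
  qed
qed

text \<open>
  The bijection \<open>\<sigma>\<close> breaks the ties of \<open>f\<close>. The flag reverses the order, which is needed in
  the intervals where the chosen edge of the pattern comes second.
\<close>

definition refines :: "'a set \<Rightarrow> bool \<Rightarrow> ('a \<Rightarrow> nat) \<Rightarrow> ('a \<Rightarrow> nat) \<Rightarrow> bool" where
  "refines Q up f \<sigma> \<longleftrightarrow>
     (\<forall>x\<in>Q. \<forall>y\<in>Q. f x < f y \<longrightarrow> (if up then \<sigma> x < \<sigma> y else \<sigma> y < \<sigma> x))"

text \<open>
  The reversals built into \<open>refines\<close> cancel those of the pattern: if the edges of \<open>x\<close> and \<open>y\<close> form \<open>P\<close>, then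
  no coordinate of \<open>x\<close> exceeds that of \<open>y\<close>, or the other way round. Then \<open>x\<close> and \<open>y\<close> have different
  ranks \<open>h\<close>, so a clique has at most as many edges as there are ranks.
\<close>

lemma largest_clique_matching_of:
  assumes P: "r_pattern r P" "r_partite r 2 P" "p \<in> P"
    and Q: "finite Q" "card (h ` Q) < m"
    and h: "\<And>x y. x \<in> Q \<Longrightarrow> y \<in> Q \<Longrightarrow> x \<noteq> y \<Longrightarrow> (\<And>i. i < r \<Longrightarrow> f i x \<le> f i y) \<Longrightarrow> h x < (h y :: nat)"
    and bij: "\<And>i. i < r \<Longrightarrow> bij_betw (\<sigma> i) Q {..<n}"
    and refines: "\<And>i. i < r \<Longrightarrow> refines Q (2 * i + 1 \<in> p) (f i) (\<sigma> i)"
  shows "largest_clique r P (matching_of r n Q \<sigma>) < m"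
proof -
  let ?e = "\<lambda>x. edge r n (\<lambda>i. \<sigma> i x)"
  have fin: "finite (matching_of r n Q \<sigma>)" using Q by (simp add: matching_of_def)
  have "card C < m" if C: "C \<subseteq> matching_of r n Q \<sigma>" "pattern_clique r P C" for C
  proof -
    obtain Q' where Q': "Q' \<subseteq> Q" "C = ?e ` Q'" "inj_on ?e Q'"
      using C(1) unfolding matching_of_def by (metis subset_image_inj)
    have "inj_on h Q'"
    proof (rule inj_onI, rule ccontr)
      fix x y assume xy: "x \<in> Q'" "y \<in> Q'" "h x = h y" "x \<noteq> y"
      have xQ: "x \<in> Q" "y \<in> Q" using xy Q' by auto
      have ne: "\<sigma> i x \<noteq> \<sigma> i y" if "i < r" for i
        using bij[OF that] xQ xy by (metis bij_betw_inv_into_left)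
      have "?e x \<noteq> ?e y" using Q'(3) xy by (auto dest: inj_onD)
      then have "order_isomorphic {?e x, ?e y} P"
        using C(2) xy Q' unfolding pattern_clique_def by auto
      then consider "\<forall>i<r. \<sigma> i x < \<sigma> i y \<longleftrightarrow> 2 * i + 1 \<in> p" | "\<forall>i<r. \<sigma> i y < \<sigma> i x \<longleftrightarrow> 2 * i + 1 \<in> p"
        using edge_pair_order_type[OF P, of "\<lambda>i. \<sigma> i x" n "\<lambda>i. \<sigma> i y"]
          bij_betw_lessThan_bound[OF bij] xQ ne by auto
      then show False
      proof cases
        case 1
        \<comment> \<open>if \<open>f i y < f i x\<close>, then \<open>refines\<close> would put the two vertices in the interval \<open>i\<close> in the other order\<close>
        have "f i x \<le> f i y" if "i < r" for i
          using 1 refines[OF that] that xQ unfolding refines_def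
          by (metis linorder_not_le order_less_asym)
        then show False using h[of x y] xQ xy by simp
      next
        case 2
        have "f i y \<le> f i x" if "i < r" for i
          using 2 refines[OF that] that xQ unfolding refines_def
          by (metis linorder_not_le order_less_asym)
        then show False using h[of y x] xQ xy by simp
      qed
    qed
    then have "card Q' = card (h ` Q')" by (simp add: card_image)
    also have "\<dots> \<le> card (h ` Q)" using Q Q' by (intro card_mono) auto
    also have "\<dots> < m" by fact
    finally show ?thesis using Q'(2,3) by (simp add: card_image)
  qed
  moreover have "pattern_clique r P {}" by (simp add: pattern_clique_def r_matching_def)
  then have "card ({} :: nat set set) \<in> {card C |C. C \<subseteq> matching_of r n Q \<sigma> \<and> pattern_clique r P C}"
    by (intro CollectI exI[of _ "{}"]) simp
  moreover have "finite {card C |C. C \<subseteq> matching_of r n Q \<sigma> \<and> pattern_clique r P C}"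
    using fin by (auto intro!: finite_subset[of _ "card ` Pow (matching_of r n Q \<sigma>)"])
  ultimately show ?thesis unfolding largest_clique_def by (subst Max_less_iff) auto
qed

section \<open>Counting the ways of breaking ties\<close>

text \<open>
  Adding the points in the order of increasing \<open>f\<close>, each new one takes the last position. Reading the
  positions backwards handles the reversed order.
\<close>

lemma ex_refining_bijection:
  assumes "finite Q"
  shows "\<exists>\<sigma>. bij_betw \<sigma> Q {..<card Q} \<and> refines Q up f \<sigma>"
proof -
  have up: "\<exists>\<sigma>. bij_betw \<sigma> Q {..<card Q} \<and> refines Q True f \<sigma>"
    using assms
  proof (induction rule: finite_ranking_induct[where f = f])
    case empty
    then show ?case by (auto simp: refines_def bij_betw_def)
  next
    case (insert x S)
    show ?case
    proof (cases "x \<in> S")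
      case True
      then show ?thesis using insert by (simp add: insert_absorb)
    next
      case False
      obtain \<sigma> where \<sigma>: "bij_betw \<sigma> S {..<card S}" "refines S True f \<sigma>" using insert by auto
      let ?\<sigma> = "\<sigma>(x := card S)"
      have "bij_betw ?\<sigma> S {..<card S}"
        using \<sigma>(1) False by (subst bij_betw_cong[where g = \<sigma>]) auto
      then have "bij_betw ?\<sigma> (S \<union> {x}) ({..<card S} \<union> {?\<sigma> x})"
        using False by (intro notIn_Un_bij_betw) auto
      then have "bij_betw ?\<sigma> (insert x S) {..<card (insert x S)}"
        using False insert by (simp add: lessThan_Suc)
      moreover have "refines (insert x S) True f ?\<sigma>"
        using \<sigma> insert(2) False bij_betw_lessThan_bound[OF \<sigma>(1)]
        by (fastforce simp: refines_def dest: leD)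
      ultimately show ?thesis by blast
    qed
  qed
  show ?thesis
  proof (cases up)
    case True
    then show ?thesis using up by simp
  next
    case False
    obtain \<sigma> where \<sigma>: "bij_betw \<sigma> Q {..<card Q}" "refines Q True f \<sigma>" using up by auto
    let ?rev = "\<lambda>k. card Q - Suc k"
    have "bij_betw ?rev {..<card Q} {..<card Q}"
      by (rule bij_betw_byWitness[where f' = ?rev]) auto
    then have "bij_betw (?rev \<circ> \<sigma>) Q {..<card Q}" using \<sigma>(1) by (rule bij_betw_trans[rotated])
    moreover have "refines Q False f (?rev \<circ> \<sigma>)"
      using \<sigma>(2) bij_betw_lessThan_bound[OF \<sigma>(1)]
      by (simp add: refines_def diff_less_mono2 Suc_less_SucD less_Suc_eq_le Suc_diff_Suc)
    ultimately show ?thesis using False by auto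
  qed
qed

definition stabiliser :: "'a set \<Rightarrow> ('a \<Rightarrow> 'b) \<Rightarrow> ('a \<Rightarrow> 'a) set" where
  "stabiliser Q f = {\<pi>. \<pi> permutes Q \<and> (\<forall>x\<in>Q. f (\<pi> x) = f x)}"

text \<open>
  The permutations \<open>\<pi>\<close> of \<open>Q\<close> are classified by the rearrangement \<open>f \<circ> \<pi>\<close>, which is one of at most
  \<open>card B ^ card Q\<close> functions. Each class is empty or a coset of the stabiliser, so it is not larger than
  the stabiliser.
\<close>

lemma fact_le_card_stabiliser:
  assumes Q: "finite Q" and B: "finite B" and f: "f ` Q \<subseteq> B"
  shows "fact (card Q) \<le> card (stabiliser Q f) * card B ^ card Q"
proof -
  define F where "F \<pi> = restrict (f \<circ> \<pi>) Q" for \<pi>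
  define S where "S = {\<pi>. \<pi> permutes Q}"
  have finS: "finite S" by (simp add: S_def Q finite_permutations)
  have fin: "finite (stabiliser Q f)"
    by (rule finite_subset[OF _ finS]) (auto simp: stabiliser_def S_def)
  have fibre: "card {\<pi> \<in> S. F \<pi> = g} \<le> card (stabiliser Q f)" for g
  proof (cases "{\<pi> \<in> S. F \<pi> = g} = {}")
    case False
    then obtain \<rho> where \<rho>: "\<rho> permutes Q" "F \<rho> = g" by (auto simp: S_def)
    \<comment> \<open>composing with the inverse of one member of the class moves the class into the stabiliser\<close>
    have "inj_on (\<lambda>\<pi>. \<pi> \<circ> inv \<rho>) {\<pi> \<in> S. F \<pi> = g}"
      by (rule inj_on_inverseI[where g = "\<lambda>\<pi>. \<pi> \<circ> \<rho>"]) (simp add: comp_assoc permutes_inv_o(2)[OF \<rho>(1)])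
    moreover have "\<pi> \<circ> inv \<rho> \<in> stabiliser Q f" if \<pi>: "\<pi> permutes Q" "F \<pi> = g" for \<pi>
    proof -
      have "f (\<pi> (inv \<rho> x)) = f x" if "x \<in> Q" for x
      proof -
        have "inv \<rho> x \<in> Q" using \<rho>(1) that by (simp add: permutes_in_image permutes_inv)
        moreover have "F \<pi> (inv \<rho> x) = F \<rho> (inv \<rho> x)" using \<pi> \<rho> by simp
        ultimately show ?thesis using \<rho>(1) by (simp add: F_def permutes_inverses)
      qed
      then show ?thesis using \<pi> \<rho> by (simp add: stabiliser_def permutes_compose permutes_inv)
    qed
    ultimately show ?thesis
      by (intro card_inj_on_le[where f = "\<lambda>\<pi>. \<pi> \<circ> inv \<rho>"] fin) (auto simp: S_def)
  next
    case True
    then show ?thesis by (simp only: card.empty)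
  qed
  have "S \<subseteq> (\<Union>g \<in> Q \<rightarrow>\<^sub>E B. {\<pi> \<in> S. F \<pi> = g})"
    using f by (fastforce simp: S_def F_def permutes_in_image)
  then have "card S \<le> card (\<Union>g \<in> Q \<rightarrow>\<^sub>E B. {\<pi> \<in> S. F \<pi> = g})"
    using finS Q B by (intro card_mono) (auto intro: finite_PiE)
  also have "\<dots> \<le> (\<Sum>g \<in> Q \<rightarrow>\<^sub>E B. card {\<pi> \<in> S. F \<pi> = g})"
    using Q B by (intro card_UN_le finite_PiE) auto
  also have "\<dots> \<le> (\<Sum>g \<in> Q \<rightarrow>\<^sub>E B. card (stabiliser Q f))" by (intro sum_mono fibre)
  also have "\<dots> = card (stabiliser Q f) * card B ^ card Q" using Q by (simp add: card_funcsetE)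
  finally show ?thesis using Q by (simp add: S_def card_permutations)
qed

text \<open>
  The general principle behind the construction, for any finite set of points with natural-number
  coordinates \<open>f i\<close> and a rank function \<open>h\<close> that is strictly increasing in the product order of the
  coordinates and takes fewer than \<open>m\<close> values. Different families of stabilising permutations \<open>\<pi>\<close> give
  different matchings: if the edge of \<open>x\<close> under \<open>\<pi>\<close> is the edge of \<open>y\<close> under \<open>\<rho>\<close>, then \<open>\<pi> j x = \<rho> j y\<close>
  for all \<open>j\<close>, so \<open>x\<close> and \<open>y\<close> agree in every coordinate and coincide.
\<close>

lemma fact_power_le_N_part:
  fixes f :: "nat \<Rightarrow> 'a \<Rightarrow> nat" and h :: "'a \<Rightarrow> nat"
  assumes P: "r_pattern r P" "r_partite r 2 P"
    and Q: "finite Q" "card (h ` Q) < m"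
    and h: "\<And>x y. x \<in> Q \<Longrightarrow> y \<in> Q \<Longrightarrow> x \<noteq> y \<Longrightarrow> (\<And>i. i < r \<Longrightarrow> f i x \<le> f i y) \<Longrightarrow> h x < h y"
    and B: "finite B" "\<And>i. i < r \<Longrightarrow> f i ` Q \<subseteq> B"
  shows "fact (card Q) ^ r \<le> N_part r P m (card Q) * (card B ^ card Q) ^ r"
proof -
  define n where "n = card Q"
  obtain p where p: "p \<in> P" using P(1) by (force simp: r_pattern_def)
  have "\<forall>i. \<exists>\<sigma>. bij_betw \<sigma> Q {..<n} \<and> refines Q (2 * i + 1 \<in> p) (f i) \<sigma>"
    using ex_refining_bijection[OF Q(1)] by (auto simp: n_def)
  then obtain \<sigma> where \<sigma>: "bij_betw (\<sigma> i) Q {..<n}" "refines Q (2 * i + 1 \<in> p) (f i) (\<sigma> i)" for i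
    by metis
  define A where "A = (\<Pi>\<^sub>E i\<in>{..<r}. stabiliser Q (f i))"
  define M where "M \<pi> = matching_of r n Q (\<lambda>i. \<sigma> i \<circ> \<pi> i)" for \<pi>
  let ?N = "{M. r_matching r {1..r * n} M \<and> r_partite r n M \<and> largest_clique r P M < m}"
  have stab: "\<pi> i permutes Q \<and> (\<forall>x\<in>Q. f i (\<pi> i x) = f i x)" if "\<pi> \<in> A" "i < r" for \<pi> i
    using that by (auto simp: A_def stabiliser_def dest: PiE_mem)
  have bij: "bij_betw (\<sigma> i \<circ> \<pi> i) Q {..<n}" if "\<pi> \<in> A" "i < r" for \<pi> i
    using stab[OF that] \<sigma>(1) by (metis bij_betw_trans permutes_imp_bij)
  have "M \<pi> \<in> ?N" if \<pi>: "\<pi> \<in> A" for \<pi>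
  proof -
    have "refines Q (2 * i + 1 \<in> p) (f i) (\<sigma> i \<circ> \<pi> i)" if "i < r" for i
      using \<sigma>(2)[of i] stab[OF \<pi> that] unfolding refines_def
      by (simp add: permutes_in_image)
    then show ?thesis unfolding M_def
      using r_matching_matching_of[where \<sigma> = "\<lambda>i. \<sigma> i \<circ> \<pi> i", OF bij[OF \<pi>]]
        r_partite_matching_of[where \<sigma> = "\<lambda>i. \<sigma> i \<circ> \<pi> i", OF bij[OF \<pi>]]
        largest_clique_matching_of[where \<sigma> = "\<lambda>i. \<sigma> i \<circ> \<pi> i" and f = f and h = h,
          OF P p Q _ bij[OF \<pi>]] h by blast
  qed
  moreover have "inj_on M A"
  proof (rule inj_onI)
    fix \<pi> \<rho> assume \<pi>: "\<pi> \<in> A" and \<rho>: "\<rho> \<in> A" and eq: "M \<pi> = M \<rho>"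
    have same: "\<pi> i x = \<rho> i x" if i: "i < r" and x: "x \<in> Q" for i x
    proof -
      have "edge r n (\<lambda>i. (\<sigma> i \<circ> \<pi> i) x) \<in> M \<rho>"
        using x eq by (auto simp: M_def matching_of_def)
      then obtain y where y: "y \<in> Q"
        "edge r n (\<lambda>i. (\<sigma> i \<circ> \<pi> i) x) = edge r n (\<lambda>i. (\<sigma> i \<circ> \<rho> i) y)"
        by (auto simp: M_def matching_of_def)
      have im: "\<pi> j x = \<rho> j y" if "j < r" for j
      proof -
        have "(\<sigma> j \<circ> \<pi> j) x = (\<sigma> j \<circ> \<rho> j) y"
          using edge_eqD[OF _ _ y(2) that] bij_betw_lessThan_bound[OF bij] \<pi> \<rho> x y(1) by blast
        moreover have "\<pi> j x \<in> Q" "\<rho> j y \<in> Q"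
          using stab[OF \<pi> that] stab[OF \<rho> that] x y by (auto simp: permutes_in_image)
        ultimately show ?thesis using \<sigma>(1)[of j] by (auto simp: bij_betw_def dest: inj_onD)
      qed
      have "f j x = f j y" if "j < r" for j
        using im[OF that] stab[OF \<pi> that] stab[OF \<rho> that] x y(1) by metis
      \<comment> \<open>distinct points with equal coordinates would satisfy both \<open>h x < h y\<close> and \<open>h y < h x\<close>\<close>
      then have "x = y" using h[of x y] h[of y x] x y(1) by fastforce
      then show ?thesis using im[OF i] by simp
    qed
    have "\<pi> i = \<rho> i" if i: "i < r" for i
    proof
      fix x show "\<pi> i x = \<rho> i x"
        using same[OF i] stab[OF \<pi> i] stab[OF \<rho> i] by (cases "x \<in> Q") (auto simp: permutes_not_in)
    qed
    then show "\<pi> = \<rho>" using \<pi> \<rho> unfolding A_def by (intro PiE_ext) auto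
  qed
  moreover have "finite ?N"
    by (rule finite_subset[of _ "Pow (Pow {1..r * n})"]) (auto simp: r_matching_def)
  ultimately have "card A \<le> N_part r P m n"
    unfolding N_part_def by (intro card_inj_on_le[where f = M]) auto
  then have le: "(\<Prod>i<r. card (stabiliser Q (f i))) \<le> N_part r P m n"
    by (simp add: A_def card_PiE)
  have "fact n ^ r = (\<Prod>i<r. fact n :: nat)" by simp
  also have "\<dots> \<le> (\<Prod>i<r. card (stabiliser Q (f i)) * card B ^ n)"
    unfolding n_def using fact_le_card_stabiliser[OF Q(1) B(1) B(2)] by (intro prod_mono) auto
  also have "\<dots> = (\<Prod>i<r. card (stabiliser Q (f i))) * (card B ^ n) ^ r"
    by (simp add: prod.distrib)
  also have "\<dots> \<le> N_part r P m n * (card B ^ n) ^ r" using le by simp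
  finally show ?thesis by (simp add: n_def)
qed

section \<open>The lattice points between two levels\<close>

text \<open>
  A slack coordinate \<open>t - sum_list x\<close> turns the inequality into an equation in one more variable.
\<close>

lemma card_lists_sum_le:
  "finite {x::nat list. length x = r \<and> sum_list x \<le> t}"
  "card {x::nat list. length x = r \<and> sum_list x \<le> t} = (t + r) choose r"
proof -
  let ?A = "{x::nat list. length x = r \<and> sum_list x \<le> t}"
  let ?B = "{x::nat list. length x = Suc r \<and> sum_list x = t}"
  have "bij_betw (\<lambda>x. (t - sum_list x) # x) ?A ?B"
    by (rule bij_betw_byWitness[where f' = tl]) (auto simp: length_Suc_conv)
  then have "card ?A = card ?B" and "finite ?A \<longleftrightarrow> finite ?B"
    by (auto dest: bij_betw_same_card bij_betw_finite)
  moreover have "card ?B = (t + r) choose t" using card_length_sum_list[of "Suc r" t] by simp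
  ultimately show c: "card ?A = (t + r) choose r" by (simp add: binomial_symmetric[of t "t + r"])
  have "card ?A > 0" unfolding c by simp
  then show "finite ?A" by (rule card_ge_0_finite)
qed

lemma sum_list_strict_mono_nth:
  fixes x y :: "nat list"
  assumes "length x = length y" "x \<noteq> y" "\<And>i. i < length x \<Longrightarrow> x ! i \<le> y ! i"
  shows "sum_list x < sum_list y"
proof -
  obtain i where i: "i < length x" "x ! i \<noteq> y ! i" using assms by (metis nth_equalityI)
  then have "x ! i < y ! i" using assms(3)[of i] by simp
  then have "(\<Sum>i<length x. x ! i) < (\<Sum>i<length x. y ! i)"
    using i assms(3) by (intro sum_strict_mono_ex1) auto
  then show ?thesis using assms(1) by (simp add: sum_list_sum_nth atLeast0LessThan)
qed

lemma fact_Suc_mult_choose: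
  "fact (Suc k) * ((t + Suc k) choose Suc k) = (t + Suc k) * (fact k * ((t + k) choose k) :: nat)"
proof -
  have "fact (Suc k) * (Suc (t + k) choose Suc k) = fact k * ((Suc (t + k) choose Suc k) * Suc k)"
    by (simp only: fact_Suc of_nat_id ac_simps)
  also have "\<dots> = Suc (t + k) * (fact k * ((t + k) choose k))"
    unfolding Suc_times_binomial_eq[symmetric] by (rule mult.left_commute)
  finally show ?thesis by (simp only: add_Suc_right)
qed

lemma Suc_power_le_fact_mult_choose: "Suc t ^ k \<le> fact k * ((t + k) choose k)"
proof (induction k)
  case (Suc k)
  have "Suc t ^ Suc k \<le> (t + Suc k) * (fact k * ((t + k) choose k))"
    using Suc by (simp only: power_Suc) (intro mult_mono; simp)
  then show ?case by (simp only: fact_Suc_mult_choose)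
qed simp

text \<open>
  With \<open>F s = (s + 1) \<dots> (s + k)\<close>, the right-hand side is \<open>(t + k + 1) F t - (c + k + 1) F c\<close>. Replacing
  \<open>F c\<close> by the larger \<open>F t\<close> leaves \<open>(t - c) F t\<close>, and every factor of \<open>F t\<close> is at least \<open>t + 1\<close>.
\<close>

lemma layer_volume_bound:
  assumes "c \<le> t"
  shows "(t - c) * Suc t ^ k \<le> fact (Suc k) * (((t + Suc k) choose Suc k) - ((c + Suc k) choose Suc k))"
proof -
  define F where "F s = (fact k * ((s + k) choose k) :: nat)" for s
  have "F c \<le> F t" unfolding F_def using assms by (intro mult_left_mono binomial_right_mono) auto
  then have "(t - c) * F t + (c + Suc k) * F c \<le> (t - c) * F t + (c + Suc k) * F t"
    by (intro add_left_mono mult_left_mono) simp_all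
  also have "\<dots> = ((t - c) + (c + Suc k)) * F t" by (rule distrib_right[symmetric])
  also have "\<dots> = (t + Suc k) * F t" using assms by (simp only: add.assoc[symmetric] le_add_diff_inverse2)
  finally have "(t - c) * F t \<le> (t + Suc k) * F t - (c + Suc k) * F c" by simp
  moreover have "(t - c) * Suc t ^ k \<le> (t - c) * F t"
    unfolding F_def by (intro mult_left_mono Suc_power_le_fact_mult_choose) simp
  moreover have "fact (Suc k) * (((t + Suc k) choose Suc k) - ((c + Suc k) choose Suc k))
      = (t + Suc k) * F t - (c + Suc k) * F c"
    by (simp only: diff_mult_distrib2 fact_Suc_mult_choose F_def)
  ultimately show ?thesis by linarith
qed

section \<open>The lower bound\<close>

text \<open>
  The term \<open>n ^ n / n!\<close> is one of the nonnegative terms of the series of \<open>exp n\<close>.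
\<close>

lemma fact_ge_power_div_exp: "(real n / exp 1) ^ n \<le> fact n"
proof -
  have "(\<Sum>k\<in>{n}. real n ^ k /\<^sub>R fact k) \<le> (\<Sum>k. real n ^ k /\<^sub>R fact k)"
    by (rule sum_le_suminf[OF summable_exp_generic]) auto
  then have "real n ^ n / fact n \<le> exp (real n)"
    by (simp add: exp_def divide_inverse mult.commute)
  then show ?thesis by (simp add: power_divide field_simps flip: exp_of_nat_mult)
qed

text \<open>
  After taking logarithms and dividing by \<open>r n\<close>, the claim reads
  \<open>(ln (m - 1) - ln r! + (r - 2) ln n) / (r - 1) \<le> ln n - ln K\<close>, which is the logarithm of the volume
  estimate \<open>vol\<close>. The factors \<open>r\<close> match since \<open>r - 1 - 1 / (r - 1) = r (r - 2) / (r - 1)\<close>.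
\<close>

lemma real_form_of_bound:
  fixes r n m K :: nat
  assumes r: "r \<ge> 2" and m: "m \<ge> 2" and n: "n > 0" and K: "K > 0"
    and vol: "(m - 1) * K ^ (r - 1) \<le> fact r * n"
  shows "exp (- (real r * real n))
      * fact r powr (- (real r / (real r - 1) * real n))
      * (real m - 1) powr (real r / (real r - 1) * real n)
      * real n powr ((real r - 1 - 1 / (real r - 1)) * real n)
      \<le> ((real n / exp 1) ^ n / real K ^ n) ^ r"
proof -
  define a where "a = real r - 1"
  have a: "a > 0" "real r = a + 1" "real (r - 1) = a" using r by (auto simp: a_def)
  have m1: "real m - 1 > 0" using m by simp
  have "real ((m - 1) * K ^ (r - 1)) \<le> real (fact r * n)" using vol by linarith
  then have "(real m - 1) * real K ^ (r - 1) \<le> fact r * real n" using m by (simp add: of_nat_diff)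
  then have "ln ((real m - 1) * real K ^ (r - 1)) \<le> ln (fact r * real n)"
    using m1 n K by (subst ln_le_cancel_iff) auto
  then have ln_vol: "ln (real m - 1) + a * ln (real K) \<le> ln (fact r) + ln (real n)"
    using m1 n K a by (simp add: ln_mult ln_realpow)
  have "- (real r / a * real n) * ln (fact r) + real r / a * real n * ln (real m - 1)
      + (a - 1 / a) * real n * ln (real n)
     = real r * real n * ((ln (real m - 1) - ln (fact r) + (a - 1) * ln (real n)) / a)"
    using a(1) unfolding a(2) by (simp add: field_simps)
  also have "\<dots> \<le> real r * real n * (ln (real n) - ln (real K))"
    using ln_vol a(1) by (intro mult_left_mono) (auto simp: field_simps)
  finally have "exp (- (real r * real n) + (- (real r / a * real n) * ln (fact r)
      + real r / a * real n * ln (real m - 1) + (a - 1 / a) * real n * ln (real n)))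
     \<le> exp (- (real r * real n) + real r * real n * (ln (real n) - ln (real K)))" by simp
  also have "\<dots> = exp (ln (((real n / exp 1) ^ n / real K ^ n) ^ r))"
    using n K by (simp add: ln_realpow ln_div algebra_simps)
  also have "\<dots> = ((real n / exp 1) ^ n / real K ^ n) ^ r" using n K by (intro exp_ln) simp
  finally have bound: "exp (- (real r * real n) + (- (real r / a * real n) * ln (fact r)
      + real r / a * real n * ln (real m - 1) + (a - 1 / a) * real n * ln (real n)))
     \<le> ((real n / exp 1) ^ n / real K ^ n) ^ r" .
  have "fact r \<noteq> (0::real)" "real m - 1 \<noteq> 0" "real n \<noteq> 0" using m1 n by auto
  then show ?thesis using bound
    unfolding a_def[symmetric] by (simp only: powr_def if_False exp_add mult.assoc)
qed

theorem theorem7p5: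
  fixes r m b n :: nat and P :: "nat set set"
  assumes "r \<ge> 2"
    and "r_pattern r P" and "r_partite r 2 P"
    and "m \<ge> 2" and "(r - 1) dvd (m - 1)"
    and "b \<ge> r * (m - 1) div (r - 1)"
    and "n = ((b + r - (m - 1) div (r - 1)) choose r) - ((b + r - r * (m - 1) div (r - 1)) choose r)"
  shows "real (N_part r P m n) \<ge>
      exp (- (real r * real n))
      * fact r powr (- (real r / (real r - 1) * real n))
      * (real m - 1) powr (real r / (real r - 1) * real n)
      * real n powr ((real r - 1 - 1 / (real r - 1)) * real n)"
proof -
  obtain s where s: "m - 1 = (r - 1) * s" using assms(5) by (auto elim: dvdE)
  have s_eq: "(m - 1) div (r - 1) = s" "r * (m - 1) div (r - 1) = r * s"
    using s assms(1) by (auto simp: mult.left_commute[of r])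
  \<comment> \<open>the sums in \<open>{c<..t}\<close>, with \<open>c = b - r s\<close> and \<open>t = b - s\<close>, form exactly \<open>m - 1\<close> levels\<close>
  have "r * s = (m - 1) + s" unfolding s using assms(1) by (cases r) auto
  with s_eq assms(6) obtain c where b: "b = c + (m - 1) + s"
    by (metis add.commute add.left_commute le_Suc_ex)
  define t where "t = c + (m - 1)"
  have t: "b + r - s = t + r" "b + r - r * s = c + r"
    using b \<open>r * s = (m - 1) + s\<close> by (auto simp: t_def)
  have n: "n = ((t + r) choose r) - ((c + r) choose r)"
    using assms(7) unfolding s_eq t by simp
  define L where "L u = {x::nat list. length x = r \<and> sum_list x \<le> u}" for u
  define Q where "Q = L t - L c"
  have L: "finite (L u)" "card (L u) = (u + r) choose r" for u
    unfolding L_def by (rule card_lists_sum_le)+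
  have finQ: "finite Q" by (simp add: Q_def L)
  have "L c \<subseteq> L t" by (auto simp: L_def t_def)
  then have cardQ: "card Q = n" by (simp add: Q_def card_Diff_subset L n)
  have "card (sum_list ` Q) \<le> card {c<..t}"
    by (intro card_mono) (auto simp: Q_def L_def)
  then have levels: "card (sum_list ` Q) < m" using assms(4) by (simp add: t_def)
  have coords: "(\<lambda>x. x ! i) ` Q \<subseteq> {..t}" if "i < r" for i
    using that elem_le_sum_list by (fastforce simp: Q_def L_def)
  have "fact (card Q) ^ r \<le> N_part r P m (card Q) * (card {..t} ^ card Q) ^ r"
  proof (rule fact_power_le_N_part[OF assms(2,3) finQ levels, where f = "\<lambda>i x. x ! i"])
    fix x y assume "x \<in> Q" "y \<in> Q" "x \<noteq> y" "\<And>i. i < r \<Longrightarrow> x ! i \<le> y ! i"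
    then show "sum_list x < sum_list y"
      by (intro sum_list_strict_mono_nth) (auto simp: Q_def L_def)
  qed (use coords in auto)
  then have "fact n ^ r \<le> N_part r P m n * (Suc t ^ n) ^ r" by (simp add: cardQ)
  then have "real (fact n ^ r) \<le> real (N_part r P m n * (Suc t ^ n) ^ r)" by linarith
  then have count: "(fact n / real (Suc t) ^ n) ^ r \<le> real (N_part r P m n)"
    by (simp add: power_divide field_simps)
  have vol: "(m - 1) * Suc t ^ (r - 1) \<le> fact r * n"
    using layer_volume_bound[of c t "r - 1"] assms(1) unfolding n by (simp add: t_def)
  \<comment> \<open>the left-hand side of the volume estimate is positive\<close>
  then have "n > 0" using assms(4) by (cases n) auto
  note real_form_of_bound[OF assms(1,4) this _ vol]
  also have "((real n / exp 1) ^ n / real (Suc t) ^ n) ^ r \<le> (fact n / real (Suc t) ^ n) ^ r"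
    by (intro power_mono divide_right_mono fact_ge_power_div_exp) auto
  also note count
  finally show ?thesis by simp
qed

end
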